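(* Let $U$ be an up rule on an $I$-graded poset $\Omega$, and let $(X_i)_{i\in I}$ be a $U$-chain. Then $(X_i)$ is a $D$-chain for some down rule $D$ on $\Omega$ if and only if $\mathrm{Prob}(X_i=u)=0$ implies $\mathrm{Prob}(X_{i+1}=v)=0$ for any $i,i+1\in I$ and any $u\in\Omega_i$, $v\in\Omega_{i+1}$ with $u\lessdot v$. In particular this holds when $(X_i)$ is positive.
   Context: Let $I\subseteq\mathbb{Z}$ be a (possibly infinite) interval of the integers. An $I$-graded poset $\Omega$ is a countable (or finite) poset together with a surjective map $\rho\colon\Omega\to I$ (the rank function) such that $u<v$ implies $\rho(u)<\rho(v)$, and $u\lessdot v$ implies $\rho(v)=\rho(u)+1$. Here $u\lessdot v$ means that $v$ covers $u$, that is, $u<v$ but there is no $w$ with $u<w<v$. The level sets are $\Omega_i=\rho^{-1}(i)$. An up rule on $\Omega$ is an assignment of a probability $U(u\rightarrow v)$ to each pair $(u,v)\in\Omega\times\Omega$ such that $U(u\rightarrow v)>0\Leftrightarrow u\lessdot v$, and $\sum_{v\in\Omega}U(u\rightarrow v)=1$ for any $u$ with non-maximal rank. A down rule is an assignment of a probability $D(u\rightarrow v)$ to each pair such that $D(u\rightarrow v)>0\Leftrightarrow v\lessdot u$, and $\sum_{v\in\Omega}D(u\rightarrow v)=1$ for any $u$ with non-minimal rank. A Markov chain $(X_i\in\Omega_i)_{i\in I}$ is a $U$-chain if $\mathrm{Prob}(X_i=u\text{ and }X_{i+1}=v)=\mathrm{Prob}(X_i=u)\,U(u\rightarrow v)$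 for any non-maximal $i\in I$ and any $u,v\in\Omega$. It is a $D$-chain if $\mathrm{Prob}(X_i=u\text{ and }X_{i-1}=v)=\mathrm{Prob}(X_i=u)\,D(u\rightarrow v)$ for any non-minimal $i\in I$ and any $u,v\in\Omega$. The chain is positive if $\mathrm{Prob}(X_i=u)>0$ for any $i\in I$ and any $u\in\Omega_i$.
   Formalization: The "if" direction additionally assumes that every element of non-minimal rank covers some element; without this no down rule exists and the claim can fail (e.g. a<b with c isolated in rank 1). The "only if" direction and the positive case are unconditional. *)

theory Defs
  imports "HOL-Probability.Probability"
begin

text \<open>Posets are given by a carrier set and a reflexive order relation on it, as in
  \<^const>\<open>partial_order_on\<close>.\<close>

definition int_interval :: "int set \<Rightarrow> bool" where
  "int_interval I \<longleftrightarrow> (\<forall>a\<in>I. \<forall>b\<in>I. {a..b} \<subseteq> I)"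

definition less_in :: "('a \<times> 'a) set \<Rightarrow> 'a \<Rightarrow> 'a \<Rightarrow> bool" where
  "less_in r u v \<longleftrightarrow> (u, v) \<in> r \<and> u \<noteq> v"

definition covered_by :: "('a \<times> 'a) set \<Rightarrow> 'a \<Rightarrow> 'a \<Rightarrow> bool" where
  "covered_by r u v \<longleftrightarrow> less_in r u v \<and> \<not> (\<exists>w. less_in r u w \<and> less_in r w v)"

definition graded_poset ::
    "int set \<Rightarrow> 'a set \<Rightarrow> ('a \<times> 'a) set \<Rightarrow> ('a \<Rightarrow> int) \<Rightarrow> bool" where
  "graded_poset I \<Omega> r \<rho> \<longleftrightarrow>
     int_interval I \<and> countable \<Omega> \<and> partial_order_on \<Omega> r \<and> \<rho> ` \<Omega> = I \<and>
     (\<forall>u\<in>\<Omega>. \<forall>v\<in>\<Omega>. less_in r u v \<longrightarrow> \<rho> u < \<rho> v) \<and>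
     (\<forall>u\<in>\<Omega>. \<forall>v\<in>\<Omega>. covered_by r u v \<longrightarrow> \<rho> v = \<rho> u + 1)"

definition level :: "'a set \<Rightarrow> ('a \<Rightarrow> int) \<Rightarrow> int \<Rightarrow> 'a set" where
  "level \<Omega> \<rho> i = {u\<in>\<Omega>. \<rho> u = i}"

definition nonmaximal :: "int set \<Rightarrow> int \<Rightarrow> bool" where
  "nonmaximal I i \<longleftrightarrow> (\<exists>j\<in>I. i < j)"

definition nonminimal :: "int set \<Rightarrow> int \<Rightarrow> bool" where
  "nonminimal I i \<longleftrightarrow> (\<exists>j\<in>I. j < i)"

definition up_rule ::
    "int set \<Rightarrow> 'a set \<Rightarrow> ('a \<times> 'a) set \<Rightarrow> ('a \<Rightarrow> int) \<Rightarrow> ('a \<Rightarrow> 'a \<Rightarrow> real) \<Rightarrow> bool" where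
  "up_rule I \<Omega> r \<rho> U \<longleftrightarrow>
     (\<forall>u\<in>\<Omega>. \<forall>v\<in>\<Omega>. U u v \<in> {0..1} \<and> (U u v > 0 \<longleftrightarrow> covered_by r u v)) \<and>
     (\<forall>u\<in>\<Omega>. nonmaximal I (\<rho> u) \<longrightarrow> ((\<lambda>v. U u v) has_sum 1) \<Omega>)"

definition down_rule ::
    "int set \<Rightarrow> 'a set \<Rightarrow> ('a \<times> 'a) set \<Rightarrow> ('a \<Rightarrow> int) \<Rightarrow> ('a \<Rightarrow> 'a \<Rightarrow> real) \<Rightarrow> bool" where
  "down_rule I \<Omega> r \<rho> D \<longleftrightarrow>
     (\<forall>u\<in>\<Omega>. \<forall>v\<in>\<Omega>. D u v \<in> {0..1} \<and> (D u v > 0 \<longleftrightarrow> covered_by r v u)) \<and>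
     (\<forall>u\<in>\<Omega>. nonminimal I (\<rho> u) \<longrightarrow> ((\<lambda>v. D u v) has_sum 1) \<Omega>)"

text \<open>Measurability into \<^term>\<open>count_space (level \<Omega> \<rho> i)\<close> includes that the value of
  \<open>X i\<close> lies in level \<open>i\<close>. As the index set may have no least element, the Markov property
  is stated for pasts over arbitrary finite windows \<open>{m..n}\<close>; since the levels are countable this
  is the same as conditioning on the whole past. The chain need not be homogeneous in time.\<close>

definition markov_chain ::
    "'w measure \<Rightarrow> int set \<Rightarrow> 'a set \<Rightarrow> ('a \<Rightarrow> int) \<Rightarrow> (int \<Rightarrow> 'w \<Rightarrow> 'a) \<Rightarrow> bool" where
  "markov_chain M I \<Omega> \<rho> X \<longleftrightarrow>
     prob_space M \<and>
     (\<forall>i\<in>I. X i \<in> measurable M (count_space (level \<Omega> \<rho> i))) \<and>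
     (\<forall>m n x. m \<in> I \<and> n + 1 \<in> I \<and> m \<le> n \<and> \<P>(\<omega> in M. \<forall>k\<in>{m..n}. X k \<omega> = x k) > 0 \<longrightarrow>
        (\<forall>v\<in>\<Omega>. \<P>(\<omega> in M. X (n + 1) \<omega> = v \<bar> \<forall>k\<in>{m..n}. X k \<omega> = x k) =
               \<P>(\<omega> in M. X (n + 1) \<omega> = v \<bar> X n \<omega> = x n)))"

definition U_chain ::
    "'w measure \<Rightarrow> int set \<Rightarrow> 'a set \<Rightarrow> ('a \<Rightarrow> int) \<Rightarrow> ('a \<Rightarrow> 'a \<Rightarrow> real)
      \<Rightarrow> (int \<Rightarrow> 'w \<Rightarrow> 'a) \<Rightarrow> bool" where
  "U_chain M I \<Omega> \<rho> U X \<longleftrightarrow>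
     markov_chain M I \<Omega> \<rho> X \<and>
     (\<forall>i\<in>I. nonmaximal I i \<longrightarrow> (\<forall>u\<in>\<Omega>. \<forall>v\<in>\<Omega>.
        \<P>(\<omega> in M. X i \<omega> = u \<and> X (i + 1) \<omega> = v) = \<P>(\<omega> in M. X i \<omega> = u) * U u v))"

definition D_chain ::
    "'w measure \<Rightarrow> int set \<Rightarrow> 'a set \<Rightarrow> ('a \<Rightarrow> int) \<Rightarrow> ('a \<Rightarrow> 'a \<Rightarrow> real)
      \<Rightarrow> (int \<Rightarrow> 'w \<Rightarrow> 'a) \<Rightarrow> bool" where
  "D_chain M I \<Omega> \<rho> D X \<longleftrightarrow>
     markov_chain M I \<Omega> \<rho> X \<and>
     (\<forall>i\<in>I. nonminimal I i \<longrightarrow> (\<forall>u\<in>\<Omega>. \<forall>v\<in>\<Omega>.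
        \<P>(\<omega> in M. X i \<omega> = u \<and> X (i - 1) \<omega> = v) = \<P>(\<omega> in M. X i \<omega> = u) * D u v))"

definition positive_chain ::
    "'w measure \<Rightarrow> int set \<Rightarrow> 'a set \<Rightarrow> ('a \<Rightarrow> int) \<Rightarrow> (int \<Rightarrow> 'w \<Rightarrow> 'a) \<Rightarrow> bool" where
  "positive_chain M I \<Omega> \<rho> X \<longleftrightarrow>
     (\<forall>i\<in>I. \<forall>u\<in>level \<Omega> \<rho> i. \<P>(\<omega> in M. X i \<omega> = u) > 0)"

text \<open>Unlike the existence of upper covers, which follows from the existence of an up rule, the
  following is a genuine extra condition. It is necessary for any down rule to exist: an element of
  non-minimal rank without lower covers cannot satisfy the positivity and the normalization
  requirement at once.\<close>

definition has_lower_covers ::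
    "int set \<Rightarrow> 'a set \<Rightarrow> ('a \<times> 'a) set \<Rightarrow> ('a \<Rightarrow> int) \<Rightarrow> bool" where
  "has_lower_covers I \<Omega> r \<rho> \<longleftrightarrow>
     (\<forall>u\<in>\<Omega>. nonminimal I (\<rho> u) \<longrightarrow> (\<exists>v\<in>\<Omega>. covered_by r v u))"

end

theory Submission
  imports Defs
begin

text \<open>The down rule is Bayes' formula. Comparing the two expressions for the joint law of
  \<open>X i\<close> and \<open>X (i + 1)\<close>, a down rule \<open>D\<close> turns \<open>X\<close> into a \<open>D\<close>-chain exactly when
  \<open>P(X (i + 1) = v) * D v u = P(X i = u) * U u v\<close>. A down rule is strictly positive on every cover,
  so if the right-hand side vanishes because \<open>X i\<close> avoids \<open>u\<close>, then \<open>X (i + 1)\<close> must avoid \<open>v\<close>: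
  null elements can only have null upper covers (\<open>D_chain_null_covers_null\<close>).

  Conversely, where \<open>v\<close> has positive probability the equation determines
  \<open>D v u = P(X i = u) * U u v / P(X (i + 1) = v)\<close>. These weights have sum \<open>1\<close> by total probability
  over the countable set \<open>\<Omega>\<close>, and they are positive on all lower covers \<open>u\<close> of \<open>v\<close> because, by the
  condition on null elements, no such \<open>u\<close> is null. Where \<open>v\<close> is null both sides of the equation are
  zero, and \<open>D v\<close> may be any probability distribution supported on precisely the lower covers of
  \<open>v\<close>; a countable set carries such a distribution as soon as it is nonempty. Both choices are made
  separately at each \<open>v\<close> in \<open>reversed_transition_exists\<close>. The Markov property is the same
  requirement for a \<open>U\<close>-chain and for a \<open>D\<close>-chain, so only this one-step equation is at stake.

  A positive chain has no null elements, and total probability shows that each of its elements of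
  non-minimal rank is reached from some lower cover (\<open>positive_has_lower_covers\<close>).\<close>

section \<open>Countable sums of probabilities\<close>

lemma (in finite_measure) has_sum_measure_UN:
  assumes A: "countable A" and sets: "\<And>i. i \<in> A \<Longrightarrow> F i \<in> sets M"
    and disj: "disjoint_family_on F A"
  shows "((\<lambda>i. measure M (F i)) has_sum measure M (\<Union>i\<in>A. F i)) A"
proof (cases "finite A")
  case True
  with sets disj have "measure M (\<Union>i\<in>A. F i) = (\<Sum>i\<in>A. measure M (F i))"
    by (intro finite_measure_finite_Union) auto
  with True show ?thesis by simp
next
  case False
  define e where "e = from_nat_into A"
  have e: "bij_betw e UNIV A"
    unfolding e_def using A False by (rule bij_betw_from_nat_into)
  have inj: "e m \<noteq> e n" if "m \<noteq> n" for m n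
    using e that by (auto simp: bij_betw_def inj_on_def)
  have eA: "e n \<in> A" for n using e by (auto simp: bij_betw_def)
  have "(\<lambda>n. measure M (F (e n))) sums measure M (\<Union>n. F (e n))"
    using sets eA disj inj
    by (intro finite_measure_UNION) (auto simp: disjoint_family_on_def)
  then have "((\<lambda>n. measure M (F (e n))) has_sum measure M (\<Union>n. F (e n))) UNIV"
    by (intro norm_summable_imp_has_sum) (auto simp: sums_iff)
  also have "(\<Union>n. F (e n)) = (\<Union>i\<in>A. F i)"
    using e by (force simp: bij_betw_def)
  finally show ?thesis
    using has_sum_reindex_bij_betw[OF e, of "\<lambda>i. measure M (F i)"] by simp
qed

lemma has_sum_pmf:
  assumes "set_pmf p \<subseteq> A"
  shows "(pmf p has_sum 1) A"
proof -
  have "((\<lambda>x. measure (measure_pmf p) {x}) has_sum measure (measure_pmf p) (\<Union>x\<in>set_pmf p. {x}))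
          (set_pmf p)"
    by (intro measure_pmf.has_sum_measure_UN) (auto simp: disjoint_family_on_def)
  moreover have "measure (measure_pmf p) (set_pmf p) = 1"
    by (subst measure_pmf.prob_eq_1) (simp_all add: AE_measure_pmf)
  ultimately have "(pmf p has_sum 1) (set_pmf p)"
    by (simp add: measure_pmf_single)
  then show ?thesis
    by (rule has_sum_cong_neutral[THEN iffD1, rotated -1]) (use assms in \<open>auto simp: set_pmf_iff\<close>)
qed

text \<open>Pushing a geometric distribution forward along an enumeration gives every element of a
  countable set positive mass.\<close>

lemma countable_full_support_pmf:
  assumes "countable A" and "A \<noteq> {}"
  shows "\<exists>p. set_pmf p = A"
proof
  show "set_pmf (map_pmf (from_nat_into A) (geometric_pmf (1 / 2))) = A"
    using assms by (simp add: set_pmf_geometric)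
qed

section \<open>Total probability along a chain\<close>

lemma nonminimal_predecessor:
  assumes "int_interval I" and "i \<in> I" and "nonminimal I i"
  shows "i - 1 \<in> I" and "nonmaximal I (i - 1)"
proof -
  obtain j where "j \<in> I" "j < i"
    using assms(3) by (auto simp: nonminimal_def)
  moreover have "{j..i} \<subseteq> I"
    using assms(1,2) \<open>j \<in> I\<close> by (auto simp: int_interval_def)
  ultimately show "i - 1 \<in> I" by auto
  show "nonmaximal I (i - 1)"
    using assms(2) by (auto simp: nonmaximal_def intro!: bexI[of _ i])
qed

lemma markov_chain_measurable:
  assumes "markov_chain M I \<Omega> \<rho> X" and "i \<in> I"
  shows "{\<omega> \<in> space M. X i \<omega> = u} \<in> sets M"
proof -
  have "X i \<in> measurable M (count_space (level \<Omega> \<rho> i))"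
    using assms by (simp add: markov_chain_def)
  then have "X i -` ({u} \<inter> level \<Omega> \<rho> i) \<inter> space M \<in> sets M"
    by (rule measurable_sets) simp
  also have "X i -` ({u} \<inter> level \<Omega> \<rho> i) \<inter> space M = {\<omega> \<in> space M. X i \<omega> = u}"
    using measurable_space[OF \<open>X i \<in> _\<close>] by auto
  finally show ?thesis .
qed

lemma markov_chain_off_level:
  assumes "markov_chain M I \<Omega> \<rho> X" and "i \<in> I" and "\<rho> u \<noteq> i"
  shows "{\<omega> \<in> space M. X i \<omega> = u} = {}"
proof -
  have "X i \<in> measurable M (count_space (level \<Omega> \<rho> i))"
    using assms by (simp add: markov_chain_def)
  from measurable_space[OF this] show ?thesis
    using assms(3) by (auto simp: level_def)
qed

lemma U_chain_joint:
  assumes "U_chain M I \<Omega> \<rho> U X" and "i \<in> I" and "nonmaximal I i" and "u \<in> \<Omega>" and "v \<in> \<Omega>"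
  shows "\<P>(\<omega> in M. X i \<omega> = u \<and> X (i + 1) \<omega> = v) = \<P>(\<omega> in M. X i \<omega> = u) * U u v"
  using assms by (simp add: U_chain_def)

lemma U_chain_total_probability:
  assumes \<Omega>: "countable \<Omega>" and X: "U_chain M I \<Omega> \<rho> U X"
    and i: "i \<in> I" "i + 1 \<in> I" and v: "v \<in> \<Omega>"
  shows "((\<lambda>u. \<P>(\<omega> in M. X i \<omega> = u) * U u v) has_sum \<P>(\<omega> in M. X (i + 1) \<omega> = v)) \<Omega>"
proof -
  have mc: "markov_chain M I \<Omega> \<rho> X" using X by (simp add: U_chain_def)
  then interpret prob_space M by (simp add: markov_chain_def)
  have "nonmaximal I i"
    using i by (auto simp: nonmaximal_def intro!: bexI[of _ "i + 1"])
  note joint = U_chain_joint[OF X i(1) this _ v]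
  have "X i \<in> measurable M (count_space (level \<Omega> \<rho> i))"
    using mc i by (simp add: markov_chain_def)
  from measurable_space[OF this] have "X i \<omega> \<in> \<Omega>" if "\<omega> \<in> space M" for \<omega>
    using that by (auto simp: level_def)
  then have U: "(\<Union>u\<in>\<Omega>. {\<omega> \<in> space M. X i \<omega> = u \<and> X (i + 1) \<omega> = v})
      = {\<omega> \<in> space M. X (i + 1) \<omega> = v}"
    by auto
  have "{\<omega> \<in> space M. X i \<omega> = u \<and> X (i + 1) \<omega> = v} \<in> sets M" for u
    using markov_chain_measurable[OF mc i(1), of u] markov_chain_measurable[OF mc i(2), of v]
    by (simp add: sets.sets_Collect_conj)
  then have "((\<lambda>u. \<P>(\<omega> in M. X i \<omega> = u \<and> X (i + 1) \<omega> = v)) has_sum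
      measure M (\<Union>u\<in>\<Omega>. {\<omega> \<in> space M. X i \<omega> = u \<and> X (i + 1) \<omega> = v})) \<Omega>"
    using \<Omega> by (intro has_sum_measure_UN) (auto simp: disjoint_family_on_def)
  then show ?thesis
    unfolding U using joint has_sum_cong by (smt (verit, best))
qed

section \<open>Null elements\<close>

definition null_covers_null ::
    "'w measure \<Rightarrow> int set \<Rightarrow> 'a set \<Rightarrow> ('a \<times> 'a) set \<Rightarrow> ('a \<Rightarrow> int) \<Rightarrow> (int \<Rightarrow> 'w \<Rightarrow> 'a) \<Rightarrow> bool"
  where
  "null_covers_null M I \<Omega> r \<rho> X \<longleftrightarrow>
     (\<forall>i. i \<in> I \<and> i + 1 \<in> I \<longrightarrow>
        (\<forall>u\<in>level \<Omega> \<rho> i. \<forall>v\<in>level \<Omega> \<rho> (i + 1). covered_by r u v \<longrightarrow>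
           \<P>(\<omega> in M. X i \<omega> = u) = 0 \<longrightarrow> \<P>(\<omega> in M. X (i + 1) \<omega> = v) = 0))"

text \<open>The joint probability is at most \<open>P(X i = u) = 0\<close> and equals \<open>P(X (i + 1) = v) * D v u\<close> with
  \<open>D v u > 0\<close>.\<close>

lemma D_chain_null_covers_null:
  assumes D: "down_rule I \<Omega> r \<rho> D" and X: "D_chain M I \<Omega> \<rho> D X"
  shows "null_covers_null M I \<Omega> r \<rho> X"
  unfolding null_covers_null_def
proof (intro allI impI ballI)
  fix i u v
  assume i: "i \<in> I \<and> i + 1 \<in> I" and u: "u \<in> level \<Omega> \<rho> i" and v: "v \<in> level \<Omega> \<rho> (i + 1)"
    and cov: "covered_by r u v" and null: "\<P>(\<omega> in M. X i \<omega> = u) = 0"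
  have mc: "markov_chain M I \<Omega> \<rho> X" using X by (simp add: D_chain_def)
  then interpret prob_space M by (simp add: markov_chain_def)
  have uv: "u \<in> \<Omega>" "v \<in> \<Omega>" using u v by (auto simp: level_def)
  have "nonminimal I (i + 1)"
    using i by (auto simp: nonminimal_def intro!: bexI[of _ i])
  then have "\<P>(\<omega> in M. X (i + 1) \<omega> = v \<and> X (i + 1 - 1) \<omega> = u)
      = \<P>(\<omega> in M. X (i + 1) \<omega> = v) * D v u"
    using X i uv by (simp only: D_chain_def)
  moreover have "\<P>(\<omega> in M. X (i + 1) \<omega> = v \<and> X (i + 1 - 1) \<omega> = u) \<le> \<P>(\<omega> in M. X i \<omega> = u)"
    using markov_chain_measurable[OF mc, of i u] i by (intro finite_measure_mono) auto
  ultimately have "\<P>(\<omega> in M. X (i + 1) \<omega> = v) * D v u = 0"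
    using null measure_nonneg[of M "{\<omega> \<in> space M. X (i + 1) \<omega> = v \<and> X (i + 1 - 1) \<omega> = u}"] by linarith
  moreover have "D v u > 0"
    using D uv cov by (auto simp: down_rule_def)
  ultimately show "\<P>(\<omega> in M. X (i + 1) \<omega> = v) = 0" by simp
qed

lemma positive_null_covers_null:
  assumes "positive_chain M I \<Omega> \<rho> X"
  shows "null_covers_null M I \<Omega> r \<rho> X"
  using assms by (force simp: null_covers_null_def positive_chain_def)

text \<open>If \<open>v\<close> had no lower cover, every term of the total probability formula for \<open>v\<close> would vanish.\<close>

lemma positive_has_lower_covers:
  assumes G: "graded_poset I \<Omega> r \<rho>" and U: "up_rule I \<Omega> r \<rho> U"
    and X: "U_chain M I \<Omega> \<rho> U X" and pos: "positive_chain M I \<Omega> \<rho> X"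
  shows "has_lower_covers I \<Omega> r \<rho>"
  unfolding has_lower_covers_def
proof (intro ballI impI)
  fix v assume v: "v \<in> \<Omega>" and nonmin: "nonminimal I (\<rho> v)"
  have I: "int_interval I" "\<rho> v \<in> I" "countable \<Omega>"
    using G v by (auto simp: graded_poset_def)
  note pred = nonminimal_predecessor[OF I(1,2) nonmin]
  have sum: "((\<lambda>u. \<P>(\<omega> in M. X (\<rho> v - 1) \<omega> = u) * U u v) has_sum \<P>(\<omega> in M. X (\<rho> v) \<omega> = v)) \<Omega>"
    using U_chain_total_probability[OF I(3) X pred(1) _ v] I(2) by simp
  show "\<exists>u\<in>\<Omega>. covered_by r u v"
  proof (rule ccontr)
    assume "\<not> ?thesis"
    then have "U u v = 0" if "u \<in> \<Omega>" for u
      using U v that by (fastforce simp: up_rule_def)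
    then have "\<P>(\<omega> in M. X (\<rho> v) \<omega> = v) = 0"
      using sum by (intro has_sum_unique[OF sum] has_sum_0) simp
    moreover have "\<P>(\<omega> in M. X (\<rho> v) \<omega> = v) > 0"
      using pos I(2) v by (simp add: positive_chain_def level_def)
    ultimately show False by simp
  qed
qed

section \<open>Reversing the chain\<close>

text \<open>The function \<open>d\<close> is the row \<open>D v\<close> of the down rule to be found. For minimal rank it has to be
  zero, otherwise it is given by Bayes' formula if \<open>v\<close> is not null, and by an arbitrary
  distribution supported on the lower covers if it is.\<close>

lemma reversed_transition_exists:
  assumes G: "graded_poset I \<Omega> r \<rho>" and U: "up_rule I \<Omega> r \<rho> U" and X: "U_chain M I \<Omega> \<rho> U X"
    and lower: "has_lower_covers I \<Omega> r \<rho>" and null: "null_covers_null M I \<Omega> r \<rho> X"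
    and v: "v \<in> \<Omega>"
  shows "\<exists>d. (\<forall>u\<in>\<Omega>. d u \<in> {0..1} \<and> (d u > 0 \<longleftrightarrow> covered_by r u v)) \<and>
             (nonminimal I (\<rho> v) \<longrightarrow> (d has_sum (1::real)) \<Omega> \<and>
               (\<forall>u\<in>\<Omega>. \<P>(\<omega> in M. X (\<rho> v) \<omega> = v) * d u = \<P>(\<omega> in M. X (\<rho> v - 1) \<omega> = u) * U u v))"
    (is "\<exists>d. ?down d \<and> (_ \<longrightarrow> ?norm d \<and> ?rev d)")
proof -
  define C where "C = {u \<in> \<Omega>. covered_by r u v}"
  define q where "q u = \<P>(\<omega> in M. X (\<rho> v - 1) \<omega> = u) * U u v" for u
  define Q where "Q = \<P>(\<omega> in M. X (\<rho> v) \<omega> = v)"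
  have I: "int_interval I" "\<rho> v \<in> I" "countable \<Omega>"
    using G v by (auto simp: graded_poset_def)
  have rank: "\<rho> u = \<rho> v - 1" if "u \<in> C" for u
    using G v that by (auto simp: graded_poset_def C_def)
  have U_nonneg: "U u v \<ge> 0" and U_pos: "U u v > 0 \<longleftrightarrow> u \<in> C" if "u \<in> \<Omega>" for u
    using U v that by (auto simp: up_rule_def C_def)
  have q_nonneg: "q u \<ge> 0" if "u \<in> \<Omega>" for u
    using U_nonneg[OF that] by (simp add: q_def)
  have sum: "(q has_sum Q) \<Omega>" if "nonminimal I (\<rho> v)"
    unfolding q_def Q_def
    using U_chain_total_probability[OF I(3) X nonminimal_predecessor(1)[OF I(1,2) that] _ v] I(2)
    by simp
  have q_le: "q u \<le> Q" if "nonminimal I (\<rho> v)" and "u \<in> \<Omega>" for u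
    using finite_sum_le_has_sum[OF sum, of "{u}"] that q_nonneg by simp
  consider "\<not> nonminimal I (\<rho> v)" | "nonminimal I (\<rho> v)" "Q = 0" | "nonminimal I (\<rho> v)" "Q > 0"
    using measure_nonneg[of M] by (fastforce simp: Q_def less_le)
  then show ?thesis
  proof cases
    case 1
    have "\<not> covered_by r u v" if "u \<in> \<Omega>" for u
    proof
      assume "covered_by r u v"
      then have "\<rho> u < \<rho> v" using rank[of u] that by (simp add: C_def)
      moreover have "\<rho> u \<in> I" using G that by (auto simp: graded_poset_def)
      ultimately show False using 1 by (auto simp: nonminimal_def)
    qed
    with 1 show ?thesis by (intro exI[of _ "\<lambda>_. 0"]) auto
  next
    case 2
    have q0: "q u = 0" if "u \<in> \<Omega>" for u
      using q_le[OF 2(1) that] q_nonneg[OF that] 2(2) by simp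
    have "countable C" "C \<noteq> {}"
      using I(3) lower v 2(1) by (auto simp: C_def has_lower_covers_def)
    then obtain p where p: "set_pmf p = C"
      using countable_full_support_pmf by blast
    have "?down (pmf p)"
      using p by (auto simp: pmf_le_1 pmf_positive_iff C_def)
    moreover have "?norm (pmf p)"
      using p by (intro has_sum_pmf) (auto simp: C_def)
    moreover have "?rev (pmf p)"
      using 2 q0 by (simp add: q_def Q_def)
    ultimately show ?thesis by blast
  next
    case 3
    have q_pos: "q u > 0 \<longleftrightarrow> u \<in> C" if u: "u \<in> \<Omega>" for u
    proof
      assume "q u > 0"
      then have "U u v \<noteq> 0" by (auto simp: q_def)
      then show "u \<in> C" using U_nonneg[OF u] U_pos[OF u] by simp
    next
      assume "u \<in> C"
      then have "\<P>(\<omega> in M. X (\<rho> v - 1) \<omega> = u) \<noteq> 0"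
        using null[unfolded null_covers_null_def, rule_format, of "\<rho> v - 1" u v]
          nonminimal_predecessor(1)[OF I(1,2) 3(1)] I(2) v rank 3(2)
        by (auto simp: C_def Q_def level_def)
      then have "\<P>(\<omega> in M. X (\<rho> v - 1) \<omega> = u) > 0"
        by (simp add: zero_less_measure_iff)
      then show "q u > 0" using U_pos[OF u] \<open>u \<in> C\<close> by (simp add: q_def)
    qed
    have "?down (\<lambda>u. q u / Q)"
      using q_nonneg q_le[OF 3(1)] q_pos 3(2) by (simp add: C_def zero_less_divide_iff)
    moreover have "?norm (\<lambda>u. q u / Q)"
      using has_sum_cmult_right[OF sum[OF 3(1)], of "1 / Q"] 3(2) by simp
    moreover have "?rev (\<lambda>u. q u / Q)"
      using 3(2) by (simp add: q_def flip: Q_def)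
    ultimately show ?thesis by (intro exI[of _ "\<lambda>u. q u / Q"] conjI impI)
  qed
qed

lemma reversed_chain_exists:
  assumes G: "graded_poset I \<Omega> r \<rho>" and U: "up_rule I \<Omega> r \<rho> U" and X: "U_chain M I \<Omega> \<rho> U X"
    and "has_lower_covers I \<Omega> r \<rho>" and "null_covers_null M I \<Omega> r \<rho> X"
  shows "\<exists>D. down_rule I \<Omega> r \<rho> D \<and> D_chain M I \<Omega> \<rho> D X"
proof -
  from reversed_transition_exists[OF assms]
  have "\<forall>v\<in>\<Omega>. \<exists>d. (\<forall>u\<in>\<Omega>. d u \<in> {0..1} \<and> (d u > 0 \<longleftrightarrow> covered_by r u v)) \<and>
             (nonminimal I (\<rho> v) \<longrightarrow> (d has_sum (1::real)) \<Omega> \<and>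
               (\<forall>u\<in>\<Omega>. \<P>(\<omega> in M. X (\<rho> v) \<omega> = v) * d u = \<P>(\<omega> in M. X (\<rho> v - 1) \<omega> = u) * U u v))"
    by (rule ballI)
  from bchoice[OF this] obtain D where D: "\<And>v. v \<in> \<Omega> \<Longrightarrow>
      (\<forall>u\<in>\<Omega>. D v u \<in> {0..1} \<and> (D v u > 0 \<longleftrightarrow> covered_by r u v)) \<and>
      (nonminimal I (\<rho> v) \<longrightarrow> (D v has_sum (1::real)) \<Omega> \<and>
        (\<forall>u\<in>\<Omega>. \<P>(\<omega> in M. X (\<rho> v) \<omega> = v) * D v u = \<P>(\<omega> in M. X (\<rho> v - 1) \<omega> = u) * U u v))"
    by blast
  have mc: "markov_chain M I \<Omega> \<rho> X" using X by (simp add: U_chain_def)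
  have rev: "\<P>(\<omega> in M. X i \<omega> = v \<and> X (i - 1) \<omega> = u) = \<P>(\<omega> in M. X i \<omega> = v) * D v u"
    if i: "i \<in> I" "nonminimal I i" and uv: "v \<in> \<Omega>" "u \<in> \<Omega>" for i u v
  proof (cases "\<rho> v = i")
    case True
    have "int_interval I" using G by (simp add: graded_poset_def)
    note pred = nonminimal_predecessor[OF this i]
    have "\<P>(\<omega> in M. X i \<omega> = v \<and> X (i - 1) \<omega> = u) = \<P>(\<omega> in M. X (i - 1) \<omega> = u) * U u v"
      using U_chain_joint[OF X pred uv(2,1)] by (simp add: conj_commute)
    then show ?thesis using D[OF uv(1)] True i(2) uv(2) by simp
  next
    case False
    from markov_chain_off_level[OF mc i(1) this]
    have "{\<omega> \<in> space M. X i \<omega> = v} = {}" "{\<omega> \<in> space M. X i \<omega> = v \<and> X (i - 1) \<omega> = u} = {}"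
      by auto
    then show ?thesis by (simp only: measure_empty mult_zero_left)
  qed
  have "down_rule I \<Omega> r \<rho> D"
    using D by (simp add: down_rule_def)
  moreover have "D_chain M I \<Omega> \<rho> D X"
    using mc rev by (simp add: D_chain_def)
  ultimately show ?thesis by blast
qed

theorem theorem3:
  fixes I :: "int set" and \<Omega> :: "'a set" and r :: "('a \<times> 'a) set" and \<rho> :: "'a \<Rightarrow> int"
    and U :: "'a \<Rightarrow> 'a \<Rightarrow> real" and M :: "'w measure" and X :: "int \<Rightarrow> 'w \<Rightarrow> 'a"
  assumes "graded_poset I \<Omega> r \<rho>"
    and "up_rule I \<Omega> r \<rho> U"
    and "U_chain M I \<Omega> \<rho> U X"
  shows "((\<exists>D. down_rule I \<Omega> r \<rho> D \<and> D_chain M I \<Omega> \<rho> D X) \<longrightarrow>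
            (\<forall>i. i \<in> I \<and> i + 1 \<in> I \<longrightarrow>
              (\<forall>u\<in>level \<Omega> \<rho> i. \<forall>v\<in>level \<Omega> \<rho> (i + 1). covered_by r u v \<longrightarrow>
                 \<P>(\<omega> in M. X i \<omega> = u) = 0 \<longrightarrow> \<P>(\<omega> in M. X (i + 1) \<omega> = v) = 0))) \<and>
         (has_lower_covers I \<Omega> r \<rho> \<longrightarrow>
            (\<forall>i. i \<in> I \<and> i + 1 \<in> I \<longrightarrow>
              (\<forall>u\<in>level \<Omega> \<rho> i. \<forall>v\<in>level \<Omega> \<rho> (i + 1). covered_by r u v \<longrightarrow>
                 \<P>(\<omega> in M. X i \<omega> = u) = 0 \<longrightarrow> \<P>(\<omega> in M. X (i + 1) \<omega> = v) = 0)) \<longrightarrow>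
            (\<exists>D. down_rule I \<Omega> r \<rho> D \<and> D_chain M I \<Omega> \<rho> D X)) \<and>
         (positive_chain M I \<Omega> \<rho> X \<longrightarrow>
            (\<exists>D. down_rule I \<Omega> r \<rho> D \<and> D_chain M I \<Omega> \<rho> D X))"
proof (intro conjI impI)
  assume "\<exists>D. down_rule I \<Omega> r \<rho> D \<and> D_chain M I \<Omega> \<rho> D X"
  then show "\<forall>i. i \<in> I \<and> i + 1 \<in> I \<longrightarrow>
      (\<forall>u\<in>level \<Omega> \<rho> i. \<forall>v\<in>level \<Omega> \<rho> (i + 1). covered_by r u v \<longrightarrow>
         \<P>(\<omega> in M. X i \<omega> = u) = 0 \<longrightarrow> \<P>(\<omega> in M. X (i + 1) \<omega> = v) = 0)"
    using D_chain_null_covers_null unfolding null_covers_null_def by blast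
next
  assume "has_lower_covers I \<Omega> r \<rho>"
    and "\<forall>i. i \<in> I \<and> i + 1 \<in> I \<longrightarrow>
      (\<forall>u\<in>level \<Omega> \<rho> i. \<forall>v\<in>level \<Omega> \<rho> (i + 1). covered_by r u v \<longrightarrow>
         \<P>(\<omega> in M. X i \<omega> = u) = 0 \<longrightarrow> \<P>(\<omega> in M. X (i + 1) \<omega> = v) = 0)"
  then show "\<exists>D. down_rule I \<Omega> r \<rho> D \<and> D_chain M I \<Omega> \<rho> D X"
    using reversed_chain_exists[OF assms] unfolding null_covers_null_def by blast
next
  assume "positive_chain M I \<Omega> \<rho> X"
  then show "\<exists>D. down_rule I \<Omega> r \<rho> D \<and> D_chain M I \<Omega> \<rho> D X"
    using reversed_chain_exists[OF assms] positive_has_lower_covers[OF assms]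
      positive_null_covers_null by blast
qed

end
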